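(* Let $T\in\mathcal{K}(V)$ be bisectorial of angle $\omega\in(0,\frac{\pi}{2})$, let $\theta\in(\omega,\frac{\pi}{2})$ and $g\in\mathcal{N}^{\mathrm{bnd}}(D_\theta)$. With the extended $\omega$-functional calculus of $T$: i) For every $B\in\mathcal{B}(V)$ with $TB\supseteq BT$, one has $Bg(T)=g(T)B$. ii) For every intrinsic polynomial $p$, one has $p[T]g(T)\supseteq g(T)p[T]$. iii) For every $f\in\mathcal{N}^{\mathrm{bnd}}(D_\theta)$, one has $g(T)f(T)=f(T)g(T)$.
   Context: Clifford setting. Fix an integer $n\geq 1$. $\mathbb{R}_n$ is the real Clifford algebra generated by $e_1,\dots,e_n$ with $e_i^2=-1$, $e_ie_j=-e_je_i$ ($i\neq j$), with basis $e_A=e_{i_1}\cdots e_{i_r}$ for $A=(i_1<\dots<i_r)$, $e_\emptyset=1$, and $|s|^2=\sum_As_A^2$ for $s=\sum_As_Ae_A$. Paravectors: $\mathbb{R}^{n+1}=\{s_0+s_1e_1+\dots+s_ne_n\}\subseteq\mathbb{R}_n$ with $\overline{s}=s_0-s_1e_1-\dots-s_ne_n$. $\mathbb{S}=\{s\in\mathbb{R}^{n+1}: s_0=0,|s|=1\}$ and $\mathbb{C}_J=\{x+Jy: x,y\in\mathbb{R}\}$ for $J\in\mathbb{S}$. $U\subseteq\mathbb{R}^{n+1}$ is axially symmetric if $x+Jy\in U$ ($x,y\in\mathbb{R}$, $J\in\mathbb{S}$) implies $x+Iy\in U$ for all $I\in\mathbb{S}$. Slice hyperholomorphic functions. For $U$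 open and axially symmetric, $f:U\to\mathbb{R}_n$ is left slice hyperholomorphic ($f\in\mathcal{SH}_L(U)$) if there are continuously differentiable $f_0,f_1:\{(x,y)\in\mathbb{R}^2: x+\mathbb{S}y\subseteq U\}\to\mathbb{R}_n$ with $f(x+Jy)=f_0(x,y)+Jf_1(x,y)$ for all $J\in\mathbb{S}$, $f_0(x,-y)=f_0(x,y)$, $f_1(x,-y)=-f_1(x,y)$, $\partial_xf_0=\partial_yf_1$, $\partial_yf_0=-\partial_xf_1$. If $f_0,f_1$ are real valued, $f$ is called intrinsic ($f\in\mathcal{N}(U)$). Operators. $V_\mathbb{R}$ is a real Banach space, $V=\{\sum_Av_A\otimes e_A: v_A\in V_\mathbb{R}\}$ the corresponding Clifford module with norm $\|v\|^2=\sum_A\|v_A\|^2$ and the natural left and right multiplications by $\mathbb{R}_n$. $\mathcal{B}(V)$: bounded everywhere defined right-linear operators; $\mathcal{K}(V)$: closed right-linear operators $T:\operatorname{dom}(T)\to V$ with right-linear domain $\operatorname{dom}(T)\subseteq V$. A Clifford number $a$ is identified with the operator $v\mapsto av$, so $(aT)v=a(Tv)$, $(Ta)v=T(av)$. For operators, $A\subseteq B$ means $\operatorname{dom}(A)\subseteq\operatorname{dom}(B)$ and $Av=Bv$ for $v\in\operatorname{dom}(A)$; products have their natural domains. For $s\in\mathbb{R}^{n+1}$, $Q_s[T]=T^2-2s_0T+|s|^2$ on $\operatorname{dom}(T^2)$; $\rho_S(T)=\{s\in\mathbb{R}^{n+1}: Q_s[T]^{-1}\in\mathcal{B}(V)\}$,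 $\sigma_S(T)=\mathbb{R}^{n+1}\setminus\rho_S(T)$, and $S_L^{-1}(s,T)=Q_s[T]^{-1}\overline{s}-TQ_s[T]^{-1}$ for $s\in\rho_S(T)$. Bisectorial operators. For $\omega\in(0,\frac{\pi}{2})$, $I_\omega=(-\omega,\omega)\cup(\pi-\omega,\pi+\omega)$ and $D_\omega=\{re^{J\phi}: r>0,\,J\in\mathbb{S},\,\phi\in I_\omega\}\subseteq\mathbb{R}^{n+1}$. $T\in\mathcal{K}(V)$ is bisectorial of angle $\omega$ if $\sigma_S(T)\subseteq\overline{D_\omega}$ and for every $\varphi\in(\omega,\frac{\pi}{2})$ there is $C_\varphi\geq 0$ with $\|S_L^{-1}(s,T)\|\leq\frac{C_\varphi}{|s|}$ for all $s\in\mathbb{R}^{n+1}\setminus(D_\varphi\cup\{0\})$. $\omega$-functional calculus. $\mathcal{SH}_L^0(D_\theta)$ is the set of bounded $f\in\mathcal{SH}_L(D_\theta)$ with $\int_0^\infty|f(te^{J\phi})|\frac{dt}{t}<\infty$ for all $J\in\mathbb{S}$, $\phi\in I_\theta$; $\mathcal{N}^0(D_\theta)$ is the set of intrinsic such functions. For $T$ bisectorial of angle $\omega$, $\theta\in(\omega,\frac{\pi}{2})$ and $f\in\mathcal{SH}_L^0(D_\theta)$, $$f(T)=\frac{1}{2\pi}\int_{\partial D_\varphi\cap\mathbb{C}_J}S_L^{-1}(s,T)ds_Jf(s):=\frac{1}{2\pi}\sum_\pm\int_\mathbb{R}S_L^{-1}(\gamma_\pm(t),T)\frac{\gamma_\pm'(t)}{J}f(\gamma_\pm(t))dt\in\mathcal{B}(V),$$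 with $\gamma_\pm(t)=\pm|t|e^{-\operatorname{sgn}(t)J\varphi}$; it does not depend on the choice of $\varphi\in(\omega,\theta)$ and $J\in\mathbb{S}$. Extended $\omega$-functional calculus. $\mathcal{N}^{\mathrm{bnd}}(D_\theta)$ is the set of functions $g(s)=g_\infty+\frac{1}{1+s^2}(g_0-g_\infty)+\widetilde{g}(s)$ on $D_\theta$ with $g_0,g_\infty\in\mathbb{R}$, $\widetilde{g}\in\mathcal{N}^0(D_\theta)$ (unique components). For such $g$, $g(T):=g_\infty+(1+T^2)^{-1}(g_0-g_\infty)+\widetilde{g}(T)\in\mathcal{B}(V)$, with $\widetilde{g}(T)$ from the $\omega$-functional calculus; here $1+T^2$ is boundedly invertible since $\mathbb{S}\subseteq\rho_S(T)$. Polynomials. An intrinsic polynomial of degree $m$ is $p(s)=p_0+p_1s+\dots+p_ms^m$ with real coefficients, $p_m\neq 0$; $p[T]=p_0+p_1T+\dots+p_mT^m$ with $\operatorname{dom}(p[T])=\operatorname{dom}(T^m)$. *)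

theory Defs
  imports "HOL-Analysis.Analysis" "HOL-Computational_Algebra.Polynomial"
begin

text \<open>
  The dimension \<open>n \<ge> 1\<close> is the cardinality of a finite linearly ordered index type \<open>'n\<close>.
  The element \<open>\<Sum>A. v A \<otimes> cl_e A\<close> of the Clifford module over a real space \<open>'v\<close> is the vector with
  components \<open>v A\<close>, indexed by the subsets \<open>A\<close> of \<open>'n\<close>; the norm of \<open>('v, 'n set) vec\<close> in the
  library is \<open>\<parallel>v\<parallel>\<^sup>2 = (\<Sum>A. \<parallel>v A\<parallel>\<^sup>2)\<close>. The Clifford algebra itself is the case \<open>'v = real\<close>.
  Beware that the library operations \<open>1\<close> and \<open>*\<close> of \<open>vec\<close> are componentwise;
  they are never used on Clifford numbers.
\<close>

type_synonym ('v, 'n) cmod = "('v, 'n set) vec"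
type_synonym 'n cliff = "(real, 'n set) vec"

definition cl_e :: "'n::{finite,linorder} set \<Rightarrow> 'n cliff" where
  "cl_e A = axis A 1"

text \<open>
  \<open>cl_e A cl_e B = csign A B cl_e (A \<triangle> B)\<close>: sorting the product \<open>cl_e A cl_e B\<close> costs one sign change for each
  pair \<open>a \<in> A\<close>, \<open>b \<in> B\<close> with \<open>b < a\<close>, and one for each \<open>i \<in> A \<inter> B\<close> because \<open>(cl_e i)\<^sup>2 = -1\<close>.
\<close>

definition csign :: "'n::{finite,linorder} set \<Rightarrow> 'n set \<Rightarrow> real" where
  "csign A B = (\<Prod>a\<in>A. \<Prod>b\<in>B. if b \<le> a then -1 else 1)"

definition cl_lmult :: "'n::{finite,linorder} cliff \<Rightarrow> ('v::real_vector, 'n) cmod \<Rightarrow> ('v, 'n) cmod"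
    (infixr "\<odot>\<^sub>L" 75) where
  "s \<odot>\<^sub>L v = (\<Sum>B\<in>UNIV. \<Sum>A\<in>UNIV. axis (sym_diff B A) ((csign B A * s $ B) *\<^sub>R v $ A))"

definition cl_rmult :: "('v::real_vector, 'n::{finite,linorder}) cmod \<Rightarrow> 'n cliff \<Rightarrow> ('v, 'n) cmod"
    (infixl "\<odot>\<^sub>R" 75) where
  "v \<odot>\<^sub>R s = (\<Sum>A\<in>UNIV. \<Sum>B\<in>UNIV. axis (sym_diff A B) ((csign A B * s $ B) *\<^sub>R v $ A))"

text \<open>
  On Clifford numbers both actions are the product of the algebra; \<open>\<odot>\<^sub>L\<close> is used for it below.
\<close>

lemma cl_rmult_eq_lmult: "s \<odot>\<^sub>R t = s \<odot>\<^sub>L t" for s t :: "'n::{finite,linorder} cliff"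
  unfolding cl_lmult_def cl_rmult_def by (simp add: mult_ac)

lemma cl_mult_basis: "cl_e A \<odot>\<^sub>L cl_e B = csign A B *\<^sub>R cl_e (sym_diff A B)"
proof -
  have "axis (sym_diff C D) ((csign C D * cl_e A $ C) *\<^sub>R cl_e B $ D)
      = (if C = A then if D = B then csign A B *\<^sub>R cl_e (sym_diff A B) else 0 else 0)" for C D
    by (auto simp: cl_e_def axis_def vec_eq_iff)
  then have "cl_e A \<odot>\<^sub>L cl_e B = (\<Sum>C\<in>UNIV. \<Sum>D\<in>UNIV.
      if C = A then if D = B then csign A B *\<^sub>R cl_e (sym_diff A B) else 0 else 0)"
    unfolding cl_lmult_def by presburger
  also have "\<dots> = (\<Sum>C\<in>UNIV. if C = A then csign A B *\<^sub>R cl_e (sym_diff A B) else 0)"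
    by (intro sum.cong refl) auto
  finally show ?thesis by simp
qed

lemma cl_generator_square: "cl_e {i} \<odot>\<^sub>L cl_e {i} = - cl_e {}"
  by (simp add: cl_mult_basis csign_def)

lemma cl_generators_anticommute: "i \<noteq> j \<Longrightarrow> cl_e {i} \<odot>\<^sub>L cl_e {j} = - (cl_e {j} \<odot>\<^sub>L cl_e {i})"
  by (cases "i < j") (auto simp: cl_mult_basis csign_def insert_commute insert_Diff_if)

lemma cl_basis_insert:
  assumes "\<And>a. a \<in> A \<Longrightarrow> i < a"
  shows "cl_e (insert i A) = cl_e {i} \<odot>\<^sub>L cl_e A"
proof -
  have "\<not> b \<le> i" if "b \<in> A" for b using assms[OF that] by simp
  then have "csign {i} A = 1" by (simp add: csign_def)
  moreover have "sym_diff {i} A = insert i A" using assms by auto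
  ultimately show ?thesis by (simp add: cl_mult_basis)
qed

lemma bilinear_cl_lmult: "bilinear (\<odot>\<^sub>L)"
  unfolding bilinear_def
  by (auto intro!: linearI simp: cl_lmult_def vec_eq_iff axis_def scaleR_sum_right
      simp flip: sum.distrib intro!: sum.cong simp: algebra_simps)

lemma cl_lmult_one: "cl_e {} \<odot>\<^sub>L v = v" for v :: "('v::real_vector, 'n::{finite,linorder}) cmod"
proof -
  have *: "(\<Sum>A\<in>UNIV. axis (sym_diff B A) ((csign B A * cl_e {} $ B) *\<^sub>R v $ A))
      = (if B = {} then \<Sum>A\<in>UNIV. axis A (v $ A) else 0)" for B
    by (cases "B = {}") (simp_all add: cl_e_def csign_def axis_def vec_eq_iff cong: if_cong)
  have "cl_e {} \<odot>\<^sub>L v = (\<Sum>B\<in>(UNIV :: 'n set set). if B = {} then \<Sum>A\<in>UNIV. axis A (v $ A) else 0)"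
    unfolding cl_lmult_def by (intro sum.cong refl *)
  also have "\<dots> = v" by (simp add: vec_eq_iff axis_def)
  finally show ?thesis .
qed

lemma csign_sym_diff_left: "csign (sym_diff A B) C = csign A C * csign B C"
proof -
  define f :: "'a \<Rightarrow> real" where "f a = (\<Prod>b\<in>C. if b \<le> a then -1 else 1)" for a
  have sq: "f a * f a = 1" for a
    unfolding f_def by (subst prod.distrib[symmetric]) (rule prod.neutral, simp)
  have "prod f (A \<inter> B) * prod f (A \<inter> B) = 1"
    by (simp add: sq flip: prod.distrib)
  moreover have "prod f A = prod f (A - B) * prod f (A \<inter> B)"
    by (subst prod.union_disjoint[symmetric]) (auto intro: prod.cong)
  moreover have "prod f B = prod f (B - A) * prod f (A \<inter> B)"
    by (subst prod.union_disjoint[symmetric]) (auto intro: prod.cong)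
  moreover have "prod f (sym_diff A B) = prod f (A - B) * prod f (B - A)"
    by (subst prod.union_disjoint) auto
  ultimately have "prod f (sym_diff A B) = prod f A * prod f B" by algebra
  then show ?thesis by (simp add: csign_def f_def)
qed

lemma csign_sym_diff_right: "csign A (sym_diff B C) = csign A B * csign A C"
proof -
  define f :: "'a \<Rightarrow> real" where "f b = (\<Prod>a\<in>A. if b \<le> a then -1 else 1)" for b
  have sw: "csign A X = prod f X" for X
    unfolding csign_def f_def by (rule prod.swap)
  have sq: "f a * f a = 1" for a
    unfolding f_def by (subst prod.distrib[symmetric]) (rule prod.neutral, simp)
  have "prod f (B \<inter> C) * prod f (B \<inter> C) = 1"
    by (simp add: sq flip: prod.distrib)
  moreover have "prod f B = prod f (B - C) * prod f (B \<inter> C)"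
    by (subst prod.union_disjoint[symmetric]) (auto intro: prod.cong)
  moreover have "prod f C = prod f (C - B) * prod f (B \<inter> C)"
    by (subst prod.union_disjoint[symmetric]) (auto intro: prod.cong)
  moreover have "prod f (sym_diff B C) = prod f (B - C) * prod f (C - B)"
    by (subst prod.union_disjoint) auto
  ultimately have "prod f (sym_diff B C) = prod f B * prod f C" by algebra
  then show ?thesis by (simp add: sw)
qed

lemma cl_basis_assoc: "(cl_e A \<odot>\<^sub>L cl_e B) \<odot>\<^sub>L cl_e C = cl_e A \<odot>\<^sub>L (cl_e B \<odot>\<^sub>L cl_e C)"
proof -
  have s: "sym_diff (sym_diff A B) C = sym_diff A (sym_diff B C)" by auto
  have "(cl_e A \<odot>\<^sub>L cl_e B) \<odot>\<^sub>L cl_e C = (csign A B * csign (sym_diff A B) C) *\<^sub>R cl_e (sym_diff (sym_diff A B) C)"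
    by (simp add: cl_mult_basis bilinear_lmul[OF bilinear_cl_lmult])
  moreover have "cl_e A \<odot>\<^sub>L (cl_e B \<odot>\<^sub>L cl_e C) = (csign B C * csign A (sym_diff B C)) *\<^sub>R cl_e (sym_diff A (sym_diff B C))"
    by (simp add: cl_mult_basis bilinear_rmul[OF bilinear_cl_lmult])
  ultimately show ?thesis
    by (simp only: s csign_sym_diff_left csign_sym_diff_right) (simp add: mult_ac)
qed

definition paravectors :: "'n::{finite,linorder} cliff set" where
  "paravectors = {s. \<forall>A. card A > 1 \<longrightarrow> s $ A = 0}"

definition pv_conj :: "'n::{finite,linorder} cliff \<Rightarrow> 'n cliff" where
  "pv_conj s = (\<chi> A. if A = {} then s $ A else - s $ A)"

text \<open>The inverse of a nonzero paravector, since \<open>s\<close> times its conjugate is \<open>\<bar>s\<bar>\<^sup>2\<close>.\<close>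

definition pv_inverse :: "'n::{finite,linorder} cliff \<Rightarrow> 'n cliff" where
  "pv_inverse s = (1 / (norm s)\<^sup>2) *\<^sub>R pv_conj s"

definition imag_units :: "'n::{finite,linorder} cliff set" where
  "imag_units = {s \<in> paravectors. s $ {} = 0 \<and> norm s = 1}"

definition slice_point :: "'n::{finite,linorder} cliff \<Rightarrow> real \<times> real \<Rightarrow> 'n cliff" where
  "slice_point J = (\<lambda>(x, y). x *\<^sub>R cl_e {} + y *\<^sub>R J)"

definition cl_cis :: "'n::{finite,linorder} cliff \<Rightarrow> real \<Rightarrow> 'n cliff" where
  "cl_cis J \<phi> = slice_point J (cos \<phi>, sin \<phi>)"

definition angles :: "real \<Rightarrow> real set" where
  "angles \<omega> = {-\<omega> <..< \<omega>} \<union> {pi - \<omega> <..< pi + \<omega>}"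

definition double_sector :: "real \<Rightarrow> 'n::{finite,linorder} cliff set" where
  "double_sector \<omega> = {r *\<^sub>R cl_cis J \<phi> | r J \<phi>. r > 0 \<and> J \<in> imag_units \<and> \<phi> \<in> angles \<omega>}"

text \<open>
  Functions on a set of paravectors are total functions on the Clifford algebra of which only the
  values on that set matter. \<open>slice_components U f f0 f1\<close> says that \<open>f0\<close>, \<open>f1\<close> witness the left
  slice hyperholomorphicity of \<open>f\<close> on an open axially symmetric \<open>U\<close>.
\<close>

definition slice_plane :: "'n::{finite,linorder} cliff set \<Rightarrow> (real \<times> real) set" where
  "slice_plane U = {p. \<forall>J\<in>imag_units. slice_point J p \<in> U}"

definition C1_with_partials ::
    "(real \<times> real) set \<Rightarrow> (real \<times> real \<Rightarrow> 'a::real_normed_vector) \<Rightarrow>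
     (real \<times> real \<Rightarrow> 'a) \<Rightarrow> (real \<times> real \<Rightarrow> 'a) \<Rightarrow> bool" where
  "C1_with_partials W h hx hy \<longleftrightarrow>
     continuous_on W hx \<and> continuous_on W hy \<and>
     (\<forall>p\<in>W. (h has_derivative (\<lambda>d. fst d *\<^sub>R hx p + snd d *\<^sub>R hy p)) (at p))"

definition slice_components ::
    "'n::{finite,linorder} cliff set \<Rightarrow> ('n cliff \<Rightarrow> 'n cliff) \<Rightarrow>
     (real \<times> real \<Rightarrow> 'n cliff) \<Rightarrow> (real \<times> real \<Rightarrow> 'n cliff) \<Rightarrow> bool" where
  "slice_components U f f0 f1 \<longleftrightarrow>
     (\<forall>p\<in>slice_plane U. \<forall>J\<in>imag_units. f (slice_point J p) = f0 p + J \<odot>\<^sub>L f1 p) \<and>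
     (\<forall>(x, y)\<in>slice_plane U. f0 (x, -y) = f0 (x, y) \<and> f1 (x, -y) = - f1 (x, y)) \<and>
     (\<exists>f0x f0y f1x f1y.
        C1_with_partials (slice_plane U) f0 f0x f0y \<and>
        C1_with_partials (slice_plane U) f1 f1x f1y \<and>
        (\<forall>p\<in>slice_plane U. f0x p = f1y p \<and> f0y p = - f1x p))"

definition SH_L :: "'n::{finite,linorder} cliff set \<Rightarrow> ('n cliff \<Rightarrow> 'n cliff) set" where
  "SH_L U = {f. \<exists>f0 f1. slice_components U f f0 f1}"

definition intrinsic :: "'n::{finite,linorder} cliff set \<Rightarrow> ('n cliff \<Rightarrow> 'n cliff) set" where
  "intrinsic U = {f. \<exists>f0 f1. slice_components U f f0 f1 \<and>
     (\<forall>p\<in>slice_plane U. f0 p \<in> range (\<lambda>r. r *\<^sub>R cl_e {}) \<and> f1 p \<in> range (\<lambda>r. r *\<^sub>R cl_e {}))}"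

definition SH_L0 :: "real \<Rightarrow> ('n::{finite,linorder} cliff \<Rightarrow> 'n cliff) set" where
  "SH_L0 \<theta> = {f \<in> SH_L (double_sector \<theta>). bounded (f ` double_sector \<theta>) \<and>
     (\<forall>J\<in>imag_units. \<forall>\<phi>\<in>angles \<theta>.
        set_integrable lborel {0<..} (\<lambda>t. norm (f (t *\<^sub>R cl_cis J \<phi>)) / t))}"

definition N0 :: "real \<Rightarrow> ('n::{finite,linorder} cliff \<Rightarrow> 'n cliff) set" where
  "N0 \<theta> = SH_L0 \<theta> \<inter> intrinsic (double_sector \<theta>)"

definition bnd_decomposition ::
    "real \<Rightarrow> ('n::{finite,linorder} cliff \<Rightarrow> 'n cliff) \<Rightarrow> real \<Rightarrow> real \<Rightarrow> ('n cliff \<Rightarrow> 'n cliff) \<Rightarrow> bool" where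
  "bnd_decomposition \<theta> g g_zero g_inf gt \<longleftrightarrow> gt \<in> N0 \<theta> \<and>
     (\<forall>s\<in>double_sector \<theta>.
        g s = g_inf *\<^sub>R cl_e {} + (g_zero - g_inf) *\<^sub>R pv_inverse (cl_e {} + s \<odot>\<^sub>L s) + gt s)"

definition N_bnd :: "real \<Rightarrow> ('n::{finite,linorder} cliff \<Rightarrow> 'n cliff) set" where
  "N_bnd \<theta> = {g. \<exists>g_zero g_inf gt. bnd_decomposition \<theta> g g_zero g_inf gt}"

text \<open>
  Operators with a domain are partial functions: \<open>dom T\<close> is the domain, \<open>\<circ>\<^sub>m\<close> the product with its
  natural domain, and \<open>A \<subseteq>\<^sub>m B\<close> the extension of operators.
\<close>

type_synonym ('v, 'n) operator = "('v, 'n) cmod \<rightharpoonup> ('v, 'n) cmod"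
type_synonym ('v, 'n) bop = "('v, 'n) cmod \<Rightarrow>\<^sub>L ('v, 'n) cmod"

definition bounded_ops :: "('v::banach, 'n::{finite,linorder}) bop set" where
  "bounded_ops = {B. \<forall>v a. blinfun_apply B (v \<odot>\<^sub>R a) = blinfun_apply B v \<odot>\<^sub>R a}"

definition op_of :: "('v::banach, 'n::{finite,linorder}) bop \<Rightarrow> ('v, 'n) operator" where
  "op_of B = (\<lambda>v. Some (blinfun_apply B v))"

definition closed_ops :: "('v::banach, 'n::{finite,linorder}) operator set" where
  "closed_ops = {T.
     T 0 = Some 0 \<and>
     (\<forall>v w v' w'. T v = Some v' \<and> T w = Some w' \<longrightarrow> T (v + w) = Some (v' + w')) \<and>
     (\<forall>v v' a. T v = Some v' \<longrightarrow> T (v \<odot>\<^sub>R a) = Some (v' \<odot>\<^sub>R a)) \<and>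
     closed {(v, w). T v = Some w}}"

primrec op_power :: "('v, 'n) operator \<Rightarrow> nat \<Rightarrow> ('v, 'n) operator" where
  "op_power T 0 = Some"
| "op_power T (Suc k) = T \<circ>\<^sub>m op_power T k"

text \<open>For \<open>p \<noteq> 0\<close> of degree \<open>m\<close> this is \<open>p[T]\<close> with domain \<open>dom (T ^ m)\<close>.\<close>

definition op_poly ::
    "real poly \<Rightarrow> ('v::banach, 'n::{finite,linorder}) operator \<Rightarrow> ('v, 'n) operator" where
  "op_poly p T = (\<lambda>v. if v \<in> dom (op_power T (degree p))
     then Some (\<Sum>k\<le>degree p. coeff p k *\<^sub>R the (op_power T k v)) else None)"

definition is_bounded_inverse ::
    "('v::banach, 'n::{finite,linorder}) operator \<Rightarrow> ('v, 'n) bop \<Rightarrow> bool" where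
  "is_bounded_inverse A R \<longleftrightarrow>
     R \<in> bounded_ops \<and> (\<forall>v w. A v = Some w \<longleftrightarrow> v = blinfun_apply R w)"

definition bounded_inverse :: "('v::banach, 'n::{finite,linorder}) operator \<Rightarrow> ('v, 'n) bop" where
  "bounded_inverse A = (THE R. is_bounded_inverse A R)"

definition Q_op ::
    "'n::{finite,linorder} cliff \<Rightarrow> ('v::banach, 'n) operator \<Rightarrow> ('v, 'n) operator" where
  "Q_op s T = op_poly [:(norm s)\<^sup>2, - 2 * s $ {}, 1:] T"

definition S_resolvent_set :: "('v::banach, 'n::{finite,linorder}) operator \<Rightarrow> 'n cliff set" where
  "S_resolvent_set T = {s \<in> paravectors. \<exists>R. is_bounded_inverse (Q_op s T) R}"

definition S_spectrum :: "('v::banach, 'n::{finite,linorder}) operator \<Rightarrow> 'n cliff set" where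
  "S_spectrum T = paravectors - S_resolvent_set T"

text \<open>
  \<open>Blinfun\<close> turns a bounded linear function into an element of the normed space of bounded operators.
  It is applied to such functions only: left multiplications are bounded because the Clifford algebra
  is finite dimensional, and for closed \<open>T\<close> and \<open>s\<close> in the resolvent set, \<open>T Q\<^sub>s[T]\<inverse>\<close> is closed and
  everywhere defined.
\<close>

definition lmult_op :: "'n::{finite,linorder} cliff \<Rightarrow> ('v::banach, 'n) bop" where
  "lmult_op a = Blinfun (\<lambda>v. a \<odot>\<^sub>L v)"

lemma bounded_linear_cl_lmult: "bounded_linear (\<lambda>v :: ('v::banach, 'n::{finite,linorder}) cmod. a \<odot>\<^sub>L v)"
proof -
  have "bounded_linear (\<lambda>v :: ('v, 'n) cmod. axis C (c *\<^sub>R v $ A))" for C A :: "'n set" and c :: real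
  proof (rule bounded_linear_intro[where K = "\<bar>c\<bar>"])
    fix v :: "('v, 'n) cmod"
    have "norm (axis C (c *\<^sub>R v $ A) :: ('v, 'n) cmod) = norm (c *\<^sub>R v $ A)"
    proof -
      have "(norm (axis C x $ i))\<^sup>2 = (if i = C then (norm x)\<^sup>2 else 0)" for x :: 'v and i
        by (simp add: axis_def)
      then show ?thesis by (simp add: norm_vec_def L2_set_def)
    qed
    also have "norm (c *\<^sub>R v $ A) \<le> norm v * \<bar>c\<bar>"
    proof -
      have "norm (v $ A) \<le> norm v"
        unfolding norm_vec_def by (rule member_le_L2_set) auto
      then show ?thesis by (simp add: mult.commute mult_left_mono)
    qed
    finally show "norm (axis C (c *\<^sub>R v $ A) :: ('v, 'n) cmod) \<le> norm v * \<bar>c\<bar>" .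
  qed (auto simp: vec_eq_iff axis_def algebra_simps)
  then show ?thesis unfolding cl_lmult_def
    by (intro bounded_linear_sum)
qed

lemma lmult_op_apply: "blinfun_apply (lmult_op a) v = a \<odot>\<^sub>L v"
  unfolding lmult_op_def by (simp add: bounded_linear_Blinfun_apply bounded_linear_cl_lmult)

definition S_L_resolvent ::
    "'n::{finite,linorder} cliff \<Rightarrow> ('v::banach, 'n) operator \<Rightarrow> ('v, 'n) bop" where
  "S_L_resolvent s T = (let R = bounded_inverse (Q_op s T) in
     Blinfun (\<lambda>v. blinfun_apply R (pv_conj s \<odot>\<^sub>L v) - the (T (blinfun_apply R v))))"

definition bisectorial :: "real \<Rightarrow> ('v::banach, 'n::{finite,linorder}) operator \<Rightarrow> bool" where
  "bisectorial \<omega> T \<longleftrightarrow>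
     S_spectrum T \<subseteq> closure (double_sector \<omega>) \<and>
     (\<forall>\<phi>\<in>{\<omega><..<pi / 2}. \<exists>C\<ge>0. \<forall>s\<in>paravectors - (double_sector \<phi> \<union> {0}).
        norm (S_L_resolvent s T) \<le> C / norm s)"

text \<open>
  The contour is given by its angle \<open>\<phi>\<close> and the imaginary unit \<open>J\<close>; \<open>\<sigma> = 1\<close> and \<open>\<sigma> = -1\<close> are the two
  branches.
\<close>

definition contour :: "real \<Rightarrow> 'n::{finite,linorder} cliff \<Rightarrow> real \<Rightarrow> real \<Rightarrow> 'n cliff" where
  "contour \<phi> J \<sigma> t = (\<sigma> * \<bar>t\<bar>) *\<^sub>R cl_cis J (- sgn t * \<phi>)"

text \<open>
  The integral takes its values in the Banach space of bounded operators, which need not be second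
  countable, so it is the gauge integral rather than the Bochner integral of the library. The
  integrand is continuous and absolutely integrable off \<open>t = 0\<close>.
\<close>

definition omega_calc ::
    "real \<Rightarrow> 'n::{finite,linorder} cliff \<Rightarrow> ('v::banach, 'n) operator \<Rightarrow> ('n cliff \<Rightarrow> 'n cliff) \<Rightarrow>
     ('v, 'n) bop" where
  "omega_calc \<phi> J T f = (1 / (2 * pi)) *\<^sub>R (\<Sum>\<sigma>\<in>{1, -1}. integral UNIV (\<lambda>t.
     S_L_resolvent (contour \<phi> J \<sigma> t) T o\<^sub>L
     lmult_op ((vector_derivative (contour \<phi> J \<sigma>) (at t) \<odot>\<^sub>L pv_inverse J)
               \<odot>\<^sub>L f (contour \<phi> J \<sigma> t))))"

text \<open>
  The decomposition is unique on the double sector, so it is immaterial which one is selected.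
\<close>

definition bnd_calc ::
    "real \<Rightarrow> real \<Rightarrow> 'n::{finite,linorder} cliff \<Rightarrow> ('v::banach, 'n) operator \<Rightarrow>
     ('n cliff \<Rightarrow> 'n cliff) \<Rightarrow> ('v, 'n) bop" where
  "bnd_calc \<theta> \<phi> J T g =
     (let (g_zero, g_inf, gt) = (SOME (g_zero, g_inf, gt). bnd_decomposition \<theta> g g_zero g_inf gt) in
        g_inf *\<^sub>R id_blinfun + (g_zero - g_inf) *\<^sub>R bounded_inverse (op_poly [:1, 0, 1:] T)
        + omega_calc \<phi> J T gt)"

end

(*
  For an intrinsic function, the values of the contour integrand at t and -t add up to a real linear
  combination of Q_s[T]^{-1} and T Q_s[T]^{-1}, because the contour points, the derivatives and the
  function values at t and -t are conjugate to each other in the plane of J. Hence every bounded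
  operator that commutes with T commutes with the integral. Conversely, an operator that commutes
  with the two bounded operators Q_J[T]^{-1} and T Q_J[T]^{-1} commutes with T; both of these commute
  with T, so g(T) commutes with T. The other two claims follow from this one and the first.
*)
theory Submission
  imports Defs
begin

subsection \<open>The closed graph theorem\<close>

lemma closed_graph_almost_bounded:
  fixes f :: "'a::banach \<Rightarrow> 'b::real_normed_vector"
  assumes "linear f"
  obtains K where "K \<ge> 0" "\<And>x e. e > 0 \<Longrightarrow> \<exists>y. norm (x - y) < e \<and> norm (f y) \<le> K * norm x"
proof -
  interpret linear f by fact
  define A where "A n = closure {x. norm (f x) \<le> real n}" for n :: nat
  have "x \<in> \<Union>(range A)" for x
  proof -
    obtain n :: nat where "norm (f x) \<le> n" using real_arch_simple by blast
    then have "x \<in> A n" unfolding A_def by (intro subsetD[OF closure_subset]) simp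
    then show ?thesis by blast
  qed
  then have "\<Union>(range A) = UNIV" by blast
  have "\<exists>n. interior (A n) \<noteq> {}"
  proof (rule ccontr)
    assume "\<nexists>n. interior (A n) \<noteq> {}"
    then have "euclidean interior_of \<Union>(range A) = {}"
      by (intro Baire_category_alt disjI1 completely_metrizable_space_euclidean)
        (auto simp: A_def)
    then show False using \<open>\<Union>(range A) = UNIV\<close> by simp
  qed
  then obtain n where "interior (A n) \<noteq> {}" by blast
  then obtain a r where r: "r > 0" "ball a r \<subseteq> A n"
    by (metis ex_in_conv mem_interior)
  have near: "\<exists>y. norm (z - y) < e \<and> norm (f y) \<le> 2 * n" if "norm z < r" "e > 0" for z e
  proof -
    have "a + z \<in> A n" "a \<in> A n"
      using r that by (auto simp: subset_iff dist_norm)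
    moreover have "e / 2 > 0" using \<open>e > 0\<close> by simp
    ultimately obtain p q where pq: "p \<in> {x. norm (f x) \<le> n}" "dist p (a + z) < e / 2"
      "q \<in> {x. norm (f x) \<le> n}" "dist q a < e / 2"
      unfolding A_def closure_approachable by metis
    have "norm ((q - a) - (p - (a + z))) < e"
      using pq norm_triangle_ineq4[of "q - a" "p - (a + z)"] unfolding dist_norm by linarith
    then have "norm (z - (p - q)) < e" by (simp add: algebra_simps)
    moreover have "norm (f (p - q)) \<le> 2 * n"
      using pq norm_triangle_ineq4[of "f p" "f q"] by (simp add: diff)
    ultimately show ?thesis by blast
  qed
  show thesis
  proof
    show "0 \<le> 4 * n / r" using r by simp
    fix x :: 'a and e :: real
    assume "e > 0"
    show "\<exists>y. norm (x - y) < e \<and> norm (f y) \<le> 4 * n / r * norm x"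
    proof (cases "x = 0")
      case True
      then show ?thesis using \<open>e > 0\<close> zero by (intro exI[of _ 0]) simp
    next
      case False
      define c where "c = r / (2 * norm x)"
      have c: "c > 0" using r False by (simp add: c_def)
      have "norm (c *\<^sub>R x) < r" using r False by (simp add: c_def)
      then obtain y where y: "norm (c *\<^sub>R x - y) < c * e" "norm (f y) \<le> 2 * n"
        using near[of "c *\<^sub>R x" "c * e"] mult_pos_pos[OF c \<open>e > 0\<close>] by blast
      have "c *\<^sub>R x - y = c *\<^sub>R (x - (1 / c) *\<^sub>R y)"
        using c by (simp add: algebra_simps)
      then have "norm (x - (1 / c) *\<^sub>R y) < e" using y c by simp
      moreover have "norm (f ((1 / c) *\<^sub>R y)) \<le> 4 * n / r * norm x"
      proof -
        have "norm (f ((1 / c) *\<^sub>R y)) = norm (f y) / c"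
          using c by (simp add: scale)
        also have "\<dots> \<le> 2 * n / c" using y c by (simp add: divide_right_mono)
        finally show ?thesis by (simp add: c_def)
      qed
      ultimately show ?thesis by blast
    qed
  qed
qed

theorem closed_graph_theorem:
  fixes f :: "'a::banach \<Rightarrow> 'b::banach"
  assumes "linear f" and "closed {(x, y). f x = y}"
  shows "bounded_linear f"
proof -
  interpret linear f by fact
  obtain K where K: "K \<ge> 0" "\<And>x e. e > 0 \<Longrightarrow> \<exists>y. norm (x - y) < e \<and> norm (f y) \<le> K * norm x"
    using closed_graph_almost_bounded[OF assms(1)] by blast
  define h where "h x e = (SOME y. norm (x - y) < e \<and> norm (f y) \<le> K * norm x)" for x e
  have h: "norm (x - h x e) < e" "norm (f (h x e)) \<le> K * norm x" if "e > 0" for x e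
    using someI_ex[OF K(2)[OF that, of x]] by (simp_all add: h_def)
  have "norm (f x) \<le> norm x * (2 * K)" for x
  proof (cases "x = 0")
    case True
    then show ?thesis by (simp add: zero)
  next
    case False
    define e where "e k = norm x * (1 / 2) ^ k" for k
    have e: "e k > 0" for k using False by (simp add: e_def)
    define X where "X = rec_nat x (\<lambda>k z. z - h z (e (Suc k)))"
    have X: "X 0 = x" "X (Suc k) = X k - h (X k) (e (Suc k))" for k
      by (simp_all add: X_def)
    have nX: "norm (X k) \<le> e k" for k
      by (cases k) (use h(1)[OF e] in \<open>simp_all add: X less_imp_le\<close>, simp add: e_def)
    define d where "d k = f (X k - X (Suc k))" for k
    have d: "norm (d k) \<le> K * e k" for k
    proof -
      have "norm (d k) \<le> K * norm (X k)"
        using h(2)[OF e, of "X k" "Suc k"] by (simp add: d_def X)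
      also have "\<dots> \<le> K * e k" using nX K(1) by (rule mult_left_mono)
      finally show ?thesis .
    qed
    have Ke: "(\<lambda>k. K * e k) sums (2 * K * norm x)"
      using sums_mult[OF geometric_sums[of "1 / 2 :: real"], of "K * norm x"]
      by (simp add: e_def mult_ac)
    have sm: "summable d"
      by (rule summable_comparison_test'[OF sums_summable[OF Ke]]) (use d in auto)
    have "sum d {..<k} = f (x - X k)" for k
      by (induction k) (simp_all add: X(1) d_def diff zero)
    then have 1: "(\<lambda>k. f (x - X k)) \<longlonglongrightarrow> suminf d"
      using summable_LIMSEQ[OF sm] by simp
    have "e \<longlonglongrightarrow> 0"
      unfolding e_def by (rule tendsto_mult_right_zero) (simp add: LIMSEQ_realpow_zero)
    then have "X \<longlonglongrightarrow> 0"
      by (rule Lim_null_comparison[rotated]) (use nX in simp)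
    then have "(\<lambda>k. x - X k) \<longlonglongrightarrow> x"
      using tendsto_diff[OF tendsto_const, of X 0 sequentially x] by simp
    with 1 have "(\<lambda>k. (x - X k, f (x - X k))) \<longlonglongrightarrow> (x, suminf d)"
      by (intro tendsto_Pair)
    then have "(x, suminf d) \<in> {(x, y). f x = y}"
      by (rule closed_sequentially[OF assms(2), rotated]) simp
    then have "f x = suminf d" by simp
    also have "norm \<dots> \<le> 2 * K * norm x"
      using norm_suminf_le[OF d sums_summable[OF Ke]] sums_unique[OF Ke] by simp
    finally show ?thesis by (simp add: mult_ac)
  qed
  then show ?thesis
    by (intro bounded_linear_intro[where K = "2 * K"]) (auto simp: add scale)
qed

subsection \<open>Clifford numbers\<close>

lemma cl_lmult_nth:
  "(s \<odot>\<^sub>L v) $ C = (\<Sum>B\<in>UNIV. (csign B (sym_diff B C) * s $ B) *\<^sub>R v $ sym_diff B C)"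
proof -
  have eq: "C = sym_diff B A \<longleftrightarrow> A = sym_diff B C" for A B C :: "'b set"
    by auto
  have "(s \<odot>\<^sub>L v) $ C = (\<Sum>B\<in>UNIV. \<Sum>A\<in>UNIV.
      if A = sym_diff B C then (csign B A * s $ B) *\<^sub>R v $ A else 0)"
    unfolding cl_lmult_def sum_component axis_def vec_lambda_beta eq[of C] ..
  then show ?thesis by (simp only: sum.delta finite_class.finite_UNIV UNIV_I if_True)
qed

lemma cl_lmult_assoc: "(s \<odot>\<^sub>L t) \<odot>\<^sub>L v = s \<odot>\<^sub>L (t \<odot>\<^sub>L v)"
proof -
  have "((s \<odot>\<^sub>L t) \<odot>\<^sub>L v) $ C = (s \<odot>\<^sub>L (t \<odot>\<^sub>L v)) $ C" for C
  proof -
    let ?f = "\<lambda>B E. (csign E (sym_diff E C) * (csign B (sym_diff B E) * s $ B) * t $ sym_diff B E)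
      *\<^sub>R v $ sym_diff E C"
    have bij: "bij (sym_diff B)" for B :: "'b set"
      by (rule involuntory_imp_bij) auto
    have term_eq: "?f B (sym_diff B D) = (csign B (sym_diff B C) * s $ B) *\<^sub>R
        ((csign D (sym_diff D (sym_diff B C)) * t $ D) *\<^sub>R v $ sym_diff D (sym_diff B C))" for B D
    proof -
      define X where "X = sym_diff D (sym_diff B C)"
      have X: "sym_diff (sym_diff B D) C = X" "sym_diff B (sym_diff B D) = D" "sym_diff B C = sym_diff D X"
        unfolding X_def by auto
      show ?thesis
        unfolding X_def[symmetric] unfolding X csign_sym_diff_left csign_sym_diff_right
        by (simp add: mult_ac)
    qed
    have "((s \<odot>\<^sub>L t) \<odot>\<^sub>L v) $ C = (\<Sum>E\<in>UNIV. \<Sum>B\<in>UNIV. ?f B E)"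
      unfolding cl_lmult_nth real_scaleR_def sum_distrib_left scaleR_sum_left by (simp add: mult_ac)
    also have "\<dots> = (\<Sum>B\<in>UNIV. \<Sum>E\<in>UNIV. ?f B E)"
      by (rule sum.swap)
    also have "\<dots> = (\<Sum>B\<in>UNIV. \<Sum>D\<in>UNIV. ?f B (sym_diff B D))"
      by (intro sum.cong refl sum.reindex_bij_betw[symmetric] bij)
    also have "\<dots> = (s \<odot>\<^sub>L (t \<odot>\<^sub>L v)) $ C"
      unfolding term_eq cl_lmult_nth scaleR_sum_right ..
    finally show ?thesis .
  qed
  then show ?thesis by (simp add: vec_eq_iff)
qed

lemma cl_lmult_one_right: "s \<odot>\<^sub>L cl_e {} = s"
proof -
  have "(csign B (sym_diff B C) * s $ B) *\<^sub>R cl_e {} $ sym_diff B C = (if B = C then s $ B else 0)" for B C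
    by (auto simp: cl_e_def axis_def csign_def)
  then show ?thesis unfolding vec_eq_iff cl_lmult_nth by simp
qed

lemma imag_unit_expansion:
  fixes J :: "'n::{finite,linorder} cliff"
  assumes "J \<in> imag_units"
  shows "J = (\<Sum>i\<in>UNIV. J $ {i} *\<^sub>R cl_e {i})" and "(\<Sum>i\<in>UNIV. (J $ {i})\<^sup>2) = 1"
proof -
  have J: "J $ A = 0" if "A \<notin> range (\<lambda>i. {i})" for A
  proof (cases "A = {}")
    case False
    then have "card A \<noteq> 0" by simp
    moreover have "card A \<noteq> 1" using that by (auto simp: card_1_singleton_iff)
    ultimately have "card A > 1" by linarith
    then show ?thesis using assms by (auto simp: imag_units_def paravectors_def)
  qed (use assms in \<open>simp add: imag_units_def\<close>)
  show "J = (\<Sum>i\<in>UNIV. J $ {i} *\<^sub>R cl_e {i})"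
  proof -
    have "J $ A = (\<Sum>i\<in>UNIV. J $ {i} *\<^sub>R cl_e {i}) $ A" for A
    proof (cases "A \<in> range (\<lambda>i. {i})")
      case True
      then obtain j where "A = {j}" by blast
      then show ?thesis by (simp add: cl_e_def axis_def if_distrib cong: if_cong)
    next
      case False
      then have "A \<noteq> {i}" for i by blast
      then show ?thesis using J[OF False] by (simp add: cl_e_def axis_def)
    qed
    then show ?thesis unfolding vec_eq_iff by blast
  qed
  have "(\<Sum>i\<in>UNIV. (J $ {i})\<^sup>2) = (\<Sum>A\<in>range (\<lambda>i. {i}). (J $ A)\<^sup>2)"
    by (subst sum.reindex) (auto simp: inj_on_def)
  also have "\<dots> = (\<Sum>A\<in>UNIV. (J $ A)\<^sup>2)"
    by (rule sum.mono_neutral_left) (use J in auto)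
  also have "\<dots> = (norm J)\<^sup>2"
    by (simp add: norm_vec_def L2_set_def sum_nonneg)
  finally show "(\<Sum>i\<in>UNIV. (J $ {i})\<^sup>2) = 1"
    using assms by (simp add: imag_units_def)
qed

lemma imag_unit_square:
  assumes "J \<in> imag_units"
  shows "J \<odot>\<^sub>L J = - cl_e {}"
proof -
  let ?x = "\<lambda>i. J $ {i}" and ?e = "\<lambda>i. cl_e {i} :: 'a cliff"
  note b = bilinear_cl_lmult
  have anti: "?e i \<odot>\<^sub>L ?e j + ?e j \<odot>\<^sub>L ?e i = (if j = i then - 2 *\<^sub>R cl_e {} else 0)" for i j
    using cl_generators_anticommute[of i j] by (simp add: cl_generator_square scaleR_2)
  have "J \<odot>\<^sub>L J = (\<Sum>i\<in>UNIV. ?x i *\<^sub>R ?e i) \<odot>\<^sub>L (\<Sum>j\<in>UNIV. ?x j *\<^sub>R ?e j)"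
    using imag_unit_expansion(1)[OF assms] by simp
  also have "\<dots> = (\<Sum>(i, j)\<in>UNIV \<times> UNIV. (?x i *\<^sub>R ?e i) \<odot>\<^sub>L (?x j *\<^sub>R ?e j))"
    by (rule bilinear_sum[OF b])
  also have "\<dots> = (\<Sum>i\<in>UNIV. \<Sum>j\<in>UNIV. (?x i * ?x j) *\<^sub>R (?e i \<odot>\<^sub>L ?e j))"
    by (simp add: sum.cartesian_product bilinear_lmul[OF b] bilinear_rmul[OF b] mult_ac)
  finally have 1: "J \<odot>\<^sub>L J = (\<Sum>i\<in>UNIV. \<Sum>j\<in>UNIV. (?x i * ?x j) *\<^sub>R (?e i \<odot>\<^sub>L ?e j))" .
  then have 2: "J \<odot>\<^sub>L J = (\<Sum>i\<in>UNIV. \<Sum>j\<in>UNIV. (?x i * ?x j) *\<^sub>R (?e j \<odot>\<^sub>L ?e i))"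
    by (subst (asm) sum.swap) (simp add: mult.commute)
  have "J \<odot>\<^sub>L J + J \<odot>\<^sub>L J = (\<Sum>i\<in>UNIV. \<Sum>j\<in>UNIV. (?x i * ?x j) *\<^sub>R (?e i \<odot>\<^sub>L ?e j + ?e j \<odot>\<^sub>L ?e i))"
    by (subst (1) 1, subst 2) (simp add: sum.distrib scaleR_add_right)
  also have "\<dots> = (\<Sum>i\<in>UNIV. \<Sum>j\<in>UNIV. if j = i then - ((2 * (?x i)\<^sup>2) *\<^sub>R cl_e {}) else 0)"
    unfolding anti by (intro sum.cong refl) (auto simp: power2_eq_square mult_ac)
  also have "\<dots> = - ((\<Sum>i\<in>UNIV. 2 * (?x i)\<^sup>2) *\<^sub>R cl_e {})"
    by (simp add: sum_negf scaleR_sum_left)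
  also have "\<dots> = - 2 *\<^sub>R cl_e {}"
    using imag_unit_expansion(2)[OF assms] by (simp flip: sum_distrib_left)
  finally have "2 *\<^sub>R (J \<odot>\<^sub>L J) = 2 *\<^sub>R (- cl_e {})"
    by (simp add: scaleR_2)
  then show ?thesis by (simp only: scaleR_cancel_left) simp
qed

definition cl_of_complex :: "'n::{finite,linorder} cliff \<Rightarrow> complex \<Rightarrow> 'n cliff" where
  "cl_of_complex J z = slice_point J (Re z, Im z)"

lemma cl_lmult_real: "(r *\<^sub>R cl_e {}) \<odot>\<^sub>L v = r *\<^sub>R v"
  by (simp add: bilinear_lmul[OF bilinear_cl_lmult] cl_lmult_one)

lemma cl_of_complex_mult:
  assumes "J \<in> imag_units"
  shows "cl_of_complex J z \<odot>\<^sub>L (cl_of_complex J w \<odot>\<^sub>L v) = cl_of_complex J (z * w) \<odot>\<^sub>L v"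
proof -
  note b = bilinear_cl_lmult
  have "J \<odot>\<^sub>L (J \<odot>\<^sub>L v) = - v"
    unfolding cl_lmult_assoc[symmetric] imag_unit_square[OF assms]
    by (simp add: bilinear_lneg[OF b] cl_lmult_one)
  then show ?thesis
    by (simp add: cl_of_complex_def slice_point_def bilinear_ladd[OF b] bilinear_radd[OF b] bilinear_lsub[OF b]
      bilinear_lmul[OF b] bilinear_rmul[OF b] cl_lmult_one algebra_simps)
qed

lemma cl_of_complex_mult_cl:
  assumes "J \<in> imag_units"
  shows "cl_of_complex J z \<odot>\<^sub>L cl_of_complex J w = cl_of_complex J (z * w)"
  using cl_of_complex_mult[OF assms, of z w "cl_e {}"] by (simp add: cl_lmult_one_right)

lemma cl_of_complex_add_cnj: "cl_of_complex J z + cl_of_complex J (cnj z) = (2 * Re z) *\<^sub>R cl_e {}"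
  by (simp add: cl_of_complex_def slice_point_def vec_eq_iff algebra_simps)

lemma pv_conj_cl_of_complex:
  assumes "J \<in> imag_units"
  shows "pv_conj (cl_of_complex J z) = cl_of_complex J (cnj z)"
  using assms by (auto simp: vec_eq_iff pv_conj_def cl_of_complex_def slice_point_def
      cl_e_def axis_def imag_units_def)

lemma pv_inverse_imag_unit:
  assumes "J \<in> imag_units"
  shows "pv_inverse J = cl_of_complex J (- \<i>)"
  using assms by (auto simp: vec_eq_iff pv_inverse_def pv_conj_def cl_of_complex_def
      slice_point_def imag_units_def)

lemma norm_pv_conj: "norm (pv_conj s) = norm s"
  by (auto simp: norm_vec_def pv_conj_def intro!: L2_set_cong)

subsection \<open>Closed operators\<close>

definition op_commutes :: "('v::banach, 'n::{finite,linorder}) bop \<Rightarrow> ('v, 'n) operator \<Rightarrow> bool" where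
  "op_commutes B T \<longleftrightarrow>
     (\<forall>v w. T v = Some w \<longrightarrow> T (blinfun_apply B v) = Some (blinfun_apply B w))"

lemma op_commutes_iff: "op_commutes B T \<longleftrightarrow> op_of B \<circ>\<^sub>m T \<subseteq>\<^sub>m T \<circ>\<^sub>m op_of B"
  by (fastforce simp: op_commutes_def map_le_def op_of_def map_comp_def split: option.splits)

lemma cl_rmult_real: "v \<odot>\<^sub>R (r *\<^sub>R cl_e {}) = r *\<^sub>R v"
proof -
  have "(\<Sum>B\<in>UNIV. axis (sym_diff A B) ((csign A B * (r *\<^sub>R cl_e {}) $ B) *\<^sub>R v $ A))
      = axis A (r *\<^sub>R v $ A)" for A
  proof -
    have "axis (sym_diff A B) ((csign A B * (r *\<^sub>R cl_e {}) $ B) *\<^sub>R v $ A)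
        = (if B = {} then axis A (r *\<^sub>R v $ A) else 0)" for B
      by (auto simp: cl_e_def csign_def axis_def vec_eq_iff)
    then show ?thesis by simp
  qed
  then show ?thesis by (simp add: cl_rmult_def vec_eq_iff axis_def)
qed

context
  fixes T :: "('v::banach, 'n::{finite,linorder}) operator"
  assumes T: "T \<in> closed_ops"
begin

lemma closed_op_add: "T v = Some v' \<Longrightarrow> T w = Some w' \<Longrightarrow> T (v + w) = Some (v' + w')"
  using T by (auto simp: closed_ops_def)

lemma closed_op_scaleR: "T v = Some w \<Longrightarrow> T (r *\<^sub>R v) = Some (r *\<^sub>R w)"
  using T cl_rmult_real[of v r] cl_rmult_real[of w r] by (metis (mono_tags, lifting) closed_ops_def mem_Collect_eq)

lemma closed_op_diff: "T v = Some v' \<Longrightarrow> T w = Some w' \<Longrightarrow> T (v - w) = Some (v' - w')"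
  using closed_op_add[of v v' "(-1) *\<^sub>R w" "(-1) *\<^sub>R w'"] closed_op_scaleR[of w w' "-1"] by simp

lemma bounded_linear_closed_op_compose:
  fixes R :: "'a::banach \<Rightarrow>\<^sub>L ('v, 'n) cmod"
  assumes "\<And>v. blinfun_apply R v \<in> dom T"
  shows "bounded_linear (\<lambda>v. the (T (blinfun_apply R v)))"
proof (rule closed_graph_theorem)
  let ?f = "\<lambda>v. the (T (blinfun_apply R v))"
  have f: "T (blinfun_apply R v) = Some (?f v)" for v
    using assms[of v] by auto
  show "linear ?f"
    by (rule linearI) (simp_all add: blinfun.add_right blinfun.scaleR_right
        closed_op_add[OF f f] closed_op_scaleR[OF f])
  have "{(x, y). ?f x = y} = (\<lambda>p. (blinfun_apply R (fst p), snd p)) -` {(v, w). T v = Some w}"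
    using f by auto
  also have "closed \<dots>"
    using T by (intro continuous_closed_vimage)
      (auto simp: closed_ops_def intro!: continuous_intros)
  finally show "closed {(x, y). ?f x = y}" .
qed

end

lemma op_power_dom_mono:
  assumes "v \<in> dom (op_power T m)" and "k \<le> m"
  shows "v \<in> dom (op_power T k)"
  using assms(2,1) by (induction rule: dec_induct) (auto simp: map_comp_Some_iff dom_def)

lemma op_commutes_power:
  assumes "op_commutes B T" 
  shows "op_commutes B (op_power T k)"
proof (induction k)
  case (Suc k)
  with assms show ?case
    by (fastforce simp: op_commutes_def map_comp_Some_iff)
qed (simp add: op_commutes_def)

lemma op_commutes_poly:
  assumes "op_commutes B T" 
  shows "op_commutes B (op_poly p T)"
  unfolding op_commutes_def
proof (intro allI impI)
  fix v w
  assume vw: "op_poly p T v = Some w"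
  let ?B = "blinfun_apply B"
  from vw have v: "v \<in> dom (op_power T (degree p))"
    and w: "w = (\<Sum>k\<le>degree p. coeff p k *\<^sub>R the (op_power T k v))"
    by (auto simp: op_poly_def split: if_splits)
  have B: "op_power T k (?B v) = Some (?B (the (op_power T k v)))" if "k \<le> degree p" for k
    using op_power_dom_mono[OF v that] op_commutes_power[OF assms, of k]
    by (auto simp: op_commutes_def)
  then have "?B v \<in> dom (op_power T (degree p))" by blast
  moreover have "(\<Sum>k\<le>degree p. coeff p k *\<^sub>R the (op_power T k (?B v))) = ?B w"
    using B by (simp add: w blinfun.sum_right blinfun.scaleR_right)
  ultimately show "op_poly p T (?B v) = Some (?B w)"
    by (simp add: op_poly_def)
qed

lemma Q_op_eq_Some_iff:
  "Q_op s T v = Some w \<longleftrightarrow>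
    (\<exists>a b. T v = Some a \<and> T a = Some b \<and> w = (norm s)\<^sup>2 *\<^sub>R v - (2 * s $ {}) *\<^sub>R a + b)"
  by (auto simp: Q_op_def op_poly_def map_comp_Some_iff numeral_2_eq_2 split: if_splits)

lemma is_bounded_inverse_unique:
  assumes "is_bounded_inverse A R" and "is_bounded_inverse A R'"
  shows "R = R'"
  using assms by (intro blinfun_eqI) (metis is_bounded_inverse_def)

lemma is_bounded_inverse_bounded_inverse:
  assumes "s \<in> S_resolvent_set T"
  shows "is_bounded_inverse (Q_op s T) (bounded_inverse (Q_op s T))"
  using assms unfolding bounded_inverse_def S_resolvent_set_def
  by (auto intro: theI2 is_bounded_inverse_unique)

lemma op_commutes_bounded_inverse:
  assumes "is_bounded_inverse A R" and "op_commutes B A"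
  shows "blinfun_apply B (blinfun_apply R v) = blinfun_apply R (blinfun_apply B v)"
  using assms by (metis is_bounded_inverse_def op_commutes_def)

context
  fixes T :: "('v::banach, 'n::{finite,linorder}) operator" and s :: "'n cliff"
    and R :: "('v, 'n) bop"
  assumes T: "T \<in> closed_ops" and R: "is_bounded_inverse (Q_op s T) R"
begin

lemma Q_inverse_dom: "blinfun_apply R v \<in> dom T"
proof -
  have "Q_op s T (blinfun_apply R v) = Some v"
    using R by (auto simp: is_bounded_inverse_def)
  then show ?thesis by (auto simp: Q_op_eq_Some_iff)
qed

lemma blinfun_apply_T_Q_inverse:
  "blinfun_apply (Blinfun (\<lambda>v. the (T (blinfun_apply R v)))) v = the (T (blinfun_apply R v))"
  by (rule fun_cong[OF bounded_linear_Blinfun_apply[OF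
      bounded_linear_closed_op_compose[OF T Q_inverse_dom]]])

lemma op_commutes_T_Q_inverse:
  assumes "op_commutes B T"
  shows "blinfun_apply B (the (T (blinfun_apply R v))) = the (T (blinfun_apply R (blinfun_apply B v)))"
proof -
  have "op_commutes B (Q_op s T)"
    unfolding Q_op_def using assms by (rule op_commutes_poly)
  then have BR: "blinfun_apply B (blinfun_apply R v) = blinfun_apply R (blinfun_apply B v)"
    by (rule op_commutes_bounded_inverse[OF R])
  obtain w where w: "T (blinfun_apply R v) = Some w"
    using Q_inverse_dom by blast
  then have "T (blinfun_apply B (blinfun_apply R v)) = Some (blinfun_apply B w)"
    using assms by (auto simp: op_commutes_def)
  then show ?thesis using w BR by simp
qed

end

lemma bounded_inverse_eq:
  assumes "is_bounded_inverse A R"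
  shows "bounded_inverse A = R"
  unfolding bounded_inverse_def using assms by (blast intro: is_bounded_inverse_unique)

lemma S_L_resolvent_apply:
  assumes T: "T \<in> closed_ops" and R: "is_bounded_inverse (Q_op s T) R"
  shows "blinfun_apply (S_L_resolvent s T) v =
    blinfun_apply R (pv_conj s \<odot>\<^sub>L v) - the (T (blinfun_apply R v))"
  unfolding S_L_resolvent_def Let_def bounded_inverse_eq[OF R]
  by (intro fun_cong[OF bounded_linear_Blinfun_apply] bounded_linear_sub
      bounded_linear_compose[OF blinfun.bounded_linear_right bounded_linear_cl_lmult]
      bounded_linear_closed_op_compose[OF T Q_inverse_dom[OF T R]])

lemma S_L_resolvent_add_cnj:
  assumes T: "T \<in> closed_ops" and J: "J \<in> imag_units"
    and R: "is_bounded_inverse (Q_op (cl_of_complex J w) T) R"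
  shows "blinfun_apply ((S_L_resolvent (cl_of_complex J w) T o\<^sub>L lmult_op (cl_of_complex J z))
      + (S_L_resolvent (cl_of_complex J (cnj w)) T o\<^sub>L lmult_op (cl_of_complex J (cnj z)))) v
    = (2 * Re (cnj w * z)) *\<^sub>R blinfun_apply R v - (2 * Re z) *\<^sub>R the (T (blinfun_apply R v))"
proof -
  define P where "P v = the (T (blinfun_apply R v))" for v
  interpret P: bounded_linear P
    unfolding P_def by (rule bounded_linear_closed_op_compose[OF T Q_inverse_dom[OF T R]])
  let ?i = "cl_of_complex J"
  have "norm (?i (cnj w)) = norm (?i w)"
    using norm_pv_conj[of "?i w"] by (simp add: pv_conj_cl_of_complex[OF J])
  moreover have "?i (cnj w) $ {} = ?i w $ {}"
    using J by (simp add: cl_of_complex_def slice_point_def imag_units_def)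
  ultimately have R': "is_bounded_inverse (Q_op (?i (cnj w)) T) R"
    using R by (simp add: Q_op_def)
  have pair: "?i u \<odot>\<^sub>L v + ?i (cnj u) \<odot>\<^sub>L v = (2 * Re u) *\<^sub>R v" for u
    by (simp only: bilinear_ladd[OF bilinear_cl_lmult, symmetric] cl_of_complex_add_cnj cl_lmult_real)
  have "blinfun_apply R (?i (cnj w) \<odot>\<^sub>L ?i z \<odot>\<^sub>L v) + blinfun_apply R (?i w \<odot>\<^sub>L ?i (cnj z) \<odot>\<^sub>L v)
      = (2 * Re (cnj w * z)) *\<^sub>R blinfun_apply R v"
    using pair[of "cnj w * z"] unfolding cl_of_complex_mult[OF J] blinfun.add_right[symmetric]
    by (simp only: complex_cnj_mult complex_cnj_cnj blinfun.scaleR_right)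
  moreover have "P (?i z \<odot>\<^sub>L v) + P (?i (cnj z) \<odot>\<^sub>L v) = (2 * Re z) *\<^sub>R P v"
    by (simp only: P.add[symmetric] pair P.scaleR)
  ultimately show ?thesis
    by (simp add: blinfun.add_left lmult_op_apply S_L_resolvent_apply[OF T R] S_L_resolvent_apply[OF T R']
        pv_conj_cl_of_complex[OF J] P_def[symmetric] algebra_simps)
qed

lemma op_commutes_Q_inverse:
  assumes T: "T \<in> closed_ops" and R: "is_bounded_inverse (Q_op s T) R"
  shows "op_commutes R T"
  unfolding op_commutes_def
proof (intro allI impI)
  fix v w
  assume vw: "T v = Some w"
  let ?u = "blinfun_apply R v"
  have "Q_op s T ?u = Some v"
    using R by (auto simp: is_bounded_inverse_def)
  then obtain a b where ab: "T ?u = Some a" "T a = Some b"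
    "v = (norm s)\<^sup>2 *\<^sub>R ?u - (2 * s $ {}) *\<^sub>R a + b"
    by (auto simp: Q_op_eq_Some_iff)
  then have "b = v - ((norm s)\<^sup>2 *\<^sub>R ?u - (2 * s $ {}) *\<^sub>R a)"
    by (simp add: algebra_simps)
  then have "T b = Some (w - ((norm s)\<^sup>2 *\<^sub>R a - (2 * s $ {}) *\<^sub>R b))"
    using ab by (auto intro!: closed_op_diff[OF T] closed_op_scaleR[OF T] vw)
  then have "Q_op s T a = Some w"
    using ab by (auto simp: Q_op_eq_Some_iff)
  then have "a = blinfun_apply R w"
    using R by (auto simp: is_bounded_inverse_def)
  then show "T ?u = Some (blinfun_apply R w)" using ab by simp
qed

text \<open>
  For \<open>v \<in> dom T\<close> all terms of \<open>A v = Q\<^sub>s[T] R A v\<close> lie in \<open>dom T\<close>, because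
  \<open>T R A v = A T R v = A R T v = R A T v \<in> dom T\<^sup>2\<close>.
\<close>

lemma op_commutes_of_Q_inverse:
  assumes T: "T \<in> closed_ops" and R: "is_bounded_inverse (Q_op s T) R"
    and AR: "\<And>v. blinfun_apply A (blinfun_apply R v) = blinfun_apply R (blinfun_apply A v)"
    and ATR: "\<And>v. blinfun_apply A (the (T (blinfun_apply R v)))
                  = the (T (blinfun_apply R (blinfun_apply A v)))"
  shows "op_commutes A T"
  unfolding op_commutes_def
proof (intro allI impI)
  fix v w
  assume vw: "T v = Some w"
  let ?A = "blinfun_apply A" and ?R = "blinfun_apply R"
  have RT: "T (?R v) = Some (?R w)"
    using op_commutes_Q_inverse[OF T R] vw by (simp add: op_commutes_def)
  have Q: "Q_op s T (?R x) = Some x" for x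
    using R by (auto simp: is_bounded_inverse_def)
  have TRA: "T (?R (?A x)) = Some (?A (the (T (?R x))))" for x
    using ATR[of x] Q_inverse_dom[OF T R, of "?A x"] by auto
  obtain a b where ab: "T (?R (?A v)) = Some a" "T a = Some b"
    "?A v = (norm s)\<^sup>2 *\<^sub>R ?R (?A v) - (2 * s $ {}) *\<^sub>R a + b"
    using Q[of "?A v"] by (auto simp: Q_op_eq_Some_iff)
  have a: "a = ?R (?A w)"
    using TRA[of v] ab(1) RT AR by simp
  obtain c where c: "T b = Some c" "?A w = (norm s)\<^sup>2 *\<^sub>R a - (2 * s $ {}) *\<^sub>R b + c"
    using Q[of "?A w"] ab(2) by (auto simp: Q_op_eq_Some_iff a)
  have "T ((norm s)\<^sup>2 *\<^sub>R ?R (?A v) - (2 * s $ {}) *\<^sub>R a + b)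
      = Some ((norm s)\<^sup>2 *\<^sub>R a - (2 * s $ {}) *\<^sub>R b + c)"
    by (intro closed_op_add[OF T] closed_op_diff[OF T] closed_op_scaleR[OF T] ab c)
  then show "T (?A v) = Some (?A w)"
    using ab(3) c(2) by simp
qed

subsection \<open>The contour\<close>

lemma has_integral_reflect_UNIV:
  fixes f :: "real \<Rightarrow> 'a::banach"
  assumes "(f has_integral i) UNIV"
  shows "((\<lambda>t. f (- t)) has_integral i) UNIV"
proof -
  have f: "f integrable_on cbox a b" for a b
    using assms unfolding has_integral_alt'[of f] by simp
  have "(\<lambda>t. f (- t)) integrable_on cbox a b" for a b
    using f[of "- b" "- a"] integrable_reflect[of f "- a" "- b"] by simp
  moreover have "\<exists>B>0. \<forall>a b. ball 0 B \<subseteq> cbox a b \<longrightarrow>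
      norm (integral (cbox a b) (\<lambda>t. f (- t)) - i) < e" if "e > 0" for e
  proof -
    obtain B where B: "B > 0"
      "\<And>a b. ball 0 B \<subseteq> cbox a b \<Longrightarrow> norm (integral (cbox a b) f - i) < e"
      using assms \<open>e > 0\<close> unfolding has_integral_alt'[of f] by auto
    have "norm (integral (cbox a b) (\<lambda>t. f (- t)) - i) < e" if "ball 0 B \<subseteq> cbox a b" for a b :: real
    proof -
      have "ball 0 B \<subseteq> cbox (- b) (- a)"
      proof
        fix x :: real
        assume "x \<in> ball 0 B"
        then have "- x \<in> cbox a b" using that by (auto simp: subset_iff)
        then show "x \<in> cbox (- b) (- a)" by auto
      qed
      then show ?thesis using B(2)[of "- b" "- a"] integral_reflect[of "- a" "- b" f] by simp
    qed
    then show ?thesis using B(1) by blast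
  qed
  ultimately show ?thesis unfolding has_integral_alt'[of "\<lambda>t. f (- t)"] by simp
qed

text \<open>If \<open>F\<close> is not integrable, then its integral is \<open>0\<close> by convention.\<close>

lemma bounded_linear_integral_reflect_zero:
  fixes F :: "real \<Rightarrow> 'a::banach" and L :: "'a \<Rightarrow> 'b::banach"
  assumes L: "bounded_linear L" and FL: "\<And>t. t \<noteq> 0 \<Longrightarrow> L (F t + F (- t)) = 0"
  shows "L (integral UNIV F) = 0"
proof (cases "F integrable_on UNIV")
  case True
  interpret bounded_linear L by fact
  have F: "(F has_integral integral UNIV F) UNIV"
    using True by (rule integrable_integral)
  have "((\<lambda>t. L (F t + F (- t))) has_integral L (integral UNIV F + integral UNIV F)) UNIV"
    using has_integral_linear[OF has_integral_add[OF F has_integral_reflect_UNIV[OF F]] L]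
    by (simp add: o_def)
  moreover have "((\<lambda>t. L (F t + F (- t))) has_integral 0) UNIV"
    by (rule has_integral_spike[of "{0}" _ _ "\<lambda>_. 0"]) (simp_all add: FL)
  ultimately have "L (integral UNIV F + integral UNIV F) = 0"
    by (rule has_integral_unique)
  then have "2 *\<^sub>R L (integral UNIV F) = 0" by (simp only: add scaleR_2)
  then show ?thesis by simp
next
  case False
  then show ?thesis by (simp add: not_integrable_integral linear_simps(3)[OF L])
qed

lemma cos_sin_angles:
  assumes "\<phi> \<in> angles \<omega>" "0 < \<omega>" "\<omega> < pi / 2"
  shows "\<bar>sin \<phi>\<bar> * cos \<omega> \<le> \<bar>cos \<phi>\<bar> * sin \<omega>"
proof -
  have *: "\<bar>sin \<psi>\<bar> * cos \<omega> \<le> \<bar>cos \<psi>\<bar> * sin \<omega>" if "- \<omega> < \<psi>" "\<psi> < \<omega>" for \<psi>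
  proof -
    have "sin (\<omega> - \<bar>\<psi>\<bar>) \<ge> 0"
      using that assms by (intro sin_ge_zero) auto
    moreover have "\<bar>sin \<psi>\<bar> = sin \<bar>\<psi>\<bar>"
    proof (cases "\<psi> \<ge> 0")
      case True
      then have "sin \<psi> \<ge> 0" using that assms by (intro sin_ge_zero) auto
      then show ?thesis using True by simp
    next
      case False
      then have "sin (- \<psi>) \<ge> 0" using that assms by (intro sin_ge_zero) auto
      then show ?thesis using False by simp
    qed
    moreover have "cos \<bar>\<psi>\<bar> = cos \<psi>" by (simp add: abs_if)
    moreover have "cos \<psi> \<ge> 0"
      using that assms by (intro cos_ge_zero) auto
    ultimately show ?thesis by (simp add: sin_diff mult.commute)
  qed
  show ?thesis
  proof (cases "\<phi> \<in> {- \<omega><..<\<omega>}")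
    case False
    then have "\<phi> - pi \<in> {- \<omega><..<\<omega>}" using assms(1) by (auto simp: angles_def)
    then show ?thesis using *[of "\<phi> - pi"] by simp
  qed (use * in auto)
qed

lemma closure_double_sector_subset:
  fixes \<omega> :: real
  assumes "0 < \<omega>" "\<omega> < pi / 2"
  shows "closure (double_sector \<omega> :: 'n::{finite,linorder} cliff set)
    \<subseteq> {s. norm (s - (s $ {}) *\<^sub>R cl_e {}) * cos \<omega> \<le> \<bar>s $ {}\<bar> * sin \<omega>}"
    (is "closure ?D \<subseteq> ?S")
proof (rule closure_minimal)
  show "closed ?S"
    by (intro closed_Collect_le continuous_intros)
  show "?D \<subseteq> ?S"
  proof
    fix s :: "'n cliff"
    assume "s \<in> double_sector \<omega>"
    then obtain r J \<phi> where s: "s = r *\<^sub>R cl_cis J \<phi>" "r > 0" "J \<in> imag_units" "\<phi> \<in> angles \<omega>"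
      by (auto simp: double_sector_def)
    have s0: "s $ {} = r * cos \<phi>"
      using s by (simp add: cl_cis_def slice_point_def cl_e_def imag_units_def)
    have "r *\<^sub>R cl_cis J \<phi> - (r * cos \<phi>) *\<^sub>R cl_e {} = (r * sin \<phi>) *\<^sub>R J"
      by (simp add: cl_cis_def slice_point_def algebra_simps)
    then have "norm (s - (s $ {}) *\<^sub>R cl_e {}) = r * \<bar>sin \<phi>\<bar>"
      using s unfolding s0 by (simp add: abs_mult imag_units_def)
    moreover have "r * (\<bar>sin \<phi>\<bar> * cos \<omega>) \<le> r * (\<bar>cos \<phi>\<bar> * sin \<omega>)"
      using cos_sin_angles[OF s(4) assms] s(2) by (intro mult_left_mono) auto
    ultimately show "s \<in> ?S"
      using s(2) by (simp add: s0 abs_mult mult_ac)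
  qed
qed

lemma cl_of_complex_in_S_resolvent_set:
  assumes \<omega>: "0 < \<omega>" "\<omega> < pi / 2" and T: "bisectorial \<omega> T" and J: "J \<in> imag_units"
    and z: "\<bar>Re z\<bar> * sin \<omega> < \<bar>Im z\<bar> * cos \<omega>"
  shows "cl_of_complex J z \<in> S_resolvent_set T"
proof -
  let ?s = "cl_of_complex J z"
  have pv: "?s \<in> paravectors"
    using J by (auto simp: paravectors_def cl_of_complex_def slice_point_def imag_units_def cl_e_def axis_def)
  have s0: "?s $ {} = Re z"
    using J by (simp add: cl_of_complex_def slice_point_def cl_e_def imag_units_def)
  have "?s - (?s $ {}) *\<^sub>R cl_e {} = Im z *\<^sub>R J"
    unfolding s0 by (simp add: cl_of_complex_def slice_point_def)
  then have "norm (?s - (?s $ {}) *\<^sub>R cl_e {}) = \<bar>Im z\<bar>"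
    using J by (simp add: imag_units_def)
  then have "?s \<notin> closure (double_sector \<omega>)"
    using closure_double_sector_subset[OF \<omega>] z by (fastforce simp: s0)
  then show ?thesis
    using T pv by (auto simp: bisectorial_def S_spectrum_def)
qed

lemma imag_unit_in_S_resolvent_set:
  assumes \<omega>: "0 < \<omega>" "\<omega> < pi / 2" and T: "bisectorial \<omega> T" and J: "J \<in> imag_units"
  shows "J \<in> S_resolvent_set T"
  using cl_of_complex_in_S_resolvent_set[OF \<omega> T J, of \<i>] \<omega>
  by (simp add: cl_of_complex_def slice_point_def cos_gt_zero)

lemma contour_eq:
  "contour \<phi> J \<sigma> t = cl_of_complex J (of_real (\<sigma> * \<bar>t\<bar>) * cis (- sgn t * \<phi>))"
  by (simp add: contour_def cl_cis_def cl_of_complex_def slice_point_def algebra_simps)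

lemma contour_minus:
  "contour \<phi> J \<sigma> (- t) = cl_of_complex J (cnj (of_real (\<sigma> * \<bar>t\<bar>) * cis (- sgn t * \<phi>)))"
  by (simp add: contour_eq sgn_minus cis_cnj)

lemma vector_derivative_contour:
  assumes "t \<noteq> 0"
  shows "vector_derivative (contour \<phi> J \<sigma>) (at t)
    = cl_of_complex J (of_real (\<sigma> * sgn t) * cis (- sgn t * \<phi>))"
proof (rule vector_derivative_at, rule has_vector_derivative_transform_within_open)
  let ?K = "cl_cis J (- sgn t * \<phi>)"
  show "((\<lambda>u. (\<sigma> * (sgn t * u)) *\<^sub>R ?K) has_vector_derivative
      cl_of_complex J (of_real (\<sigma> * sgn t) * cis (- sgn t * \<phi>))) (at t)"
    by (auto intro!: derivative_eq_intros
        simp: has_real_derivative_iff_has_vector_derivative[symmetric] has_field_derivative_def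
          cl_of_complex_def cl_cis_def slice_point_def algebra_simps)
  show "open (if t > 0 then {0<..} else {..<0 :: real})" by simp
  show "t \<in> (if t > 0 then {0<..} else {..<0})" using assms by auto
  show "(\<sigma> * (sgn t * u)) *\<^sub>R ?K = contour \<phi> J \<sigma> u" if "u \<in> (if t > 0 then {0<..} else {..<0})" for u
    using that assms by (auto simp: contour_def sgn_if split: if_splits)
qed

lemma contour_in_double_sector:
  assumes "\<sigma> \<in> {1, -1}" "t \<noteq> 0" "0 < \<phi>" "\<phi> < \<theta>" "J \<in> imag_units"
  shows "contour \<phi> J \<sigma> t \<in> double_sector \<theta>"
proof -
  define \<psi> where "\<psi> = (if \<sigma> = 1 then - sgn t * \<phi> else pi - sgn t * \<phi>)"
  have "contour \<phi> J \<sigma> t = \<bar>t\<bar> *\<^sub>R cl_cis J \<psi>"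
    using assms(1) by (auto simp: contour_def \<psi>_def cl_cis_def slice_point_def algebra_simps)
  moreover have "\<psi> \<in> angles \<theta>"
    using assms by (auto simp: \<psi>_def angles_def sgn_if)
  ultimately show ?thesis
    using assms(2,5) unfolding double_sector_def by force
qed

lemma intrinsic_on_contour:
  assumes f: "f \<in> intrinsic (double_sector \<theta>)" and \<phi>: "0 < \<phi>" "\<phi> < \<theta>"
    and "\<sigma> \<in> {1, -1}" "t \<noteq> 0" and J: "J \<in> imag_units"
  obtains c where "f (contour \<phi> J \<sigma> t) = cl_of_complex J c"
    "f (contour \<phi> J \<sigma> (- t)) = cl_of_complex J (cnj c)"
proof -
  define w where "w = of_real (\<sigma> * \<bar>t\<bar>) * cis (- sgn t * \<phi>)"
  have c: "contour \<phi> J \<sigma> t = slice_point J (Re w, Im w)"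
    "contour \<phi> J \<sigma> (- t) = slice_point J (Re w, - Im w)" for J :: "'a cliff"
    unfolding contour_eq[of \<phi> J \<sigma> t] contour_minus w_def cl_of_complex_def by simp_all
  have p: "(Re w, Im w) \<in> slice_plane (double_sector \<theta> :: 'a cliff set)"
    unfolding slice_plane_def mem_Collect_eq c[symmetric]
    by (intro ballI contour_in_double_sector assms)
  have "(Re w, - Im w) \<in> slice_plane (double_sector \<theta> :: 'a cliff set)"
    unfolding slice_plane_def mem_Collect_eq c[symmetric]
    using assms by (intro ballI contour_in_double_sector) auto
  then obtain f0 f1 a b where
    "f (slice_point J (Re w, Im w)) = f0 (Re w, Im w) + J \<odot>\<^sub>L f1 (Re w, Im w)"
    "f (slice_point J (Re w, - Im w)) = f0 (Re w, - Im w) + J \<odot>\<^sub>L f1 (Re w, - Im w)"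
    "f0 (Re w, - Im w) = f0 (Re w, Im w)" "f1 (Re w, - Im w) = - f1 (Re w, Im w)"
    "f0 (Re w, Im w) = a *\<^sub>R cl_e {}" "f1 (Re w, Im w) = b *\<^sub>R cl_e {}"
    using f p J unfolding intrinsic_def slice_components_def by (auto 0 3)
  then show thesis
    by (intro that[of "Complex a b"]) (simp_all add: c cl_of_complex_def slice_point_def bilinear_rmul[OF bilinear_cl_lmult]
      bilinear_rneg[OF bilinear_cl_lmult] cl_lmult_one_right)
qed

subsection \<open>The functional calculus\<close>

lemma contour_in_S_resolvent_set:
  assumes \<omega>: "0 < \<omega>" "\<omega> < pi / 2" and T: "bisectorial \<omega> T" and J: "J \<in> imag_units"
    and \<phi>: "\<omega> < \<phi>" "\<phi> < pi / 2" and \<sigma>: "\<sigma> \<in> {1, -1}" and t: "t \<noteq> 0"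
  shows "contour \<phi> J \<sigma> t \<in> S_resolvent_set T"
  unfolding contour_eq
proof (rule cl_of_complex_in_S_resolvent_set[OF \<omega> T J])
  have "sin (\<phi> - \<omega>) > 0" using assms by (intro sin_gt_zero) auto
  then have "cos \<phi> * sin \<omega> < sin \<phi> * cos \<omega>" by (simp add: sin_diff)
  moreover have "cos \<phi> > 0" "sin \<phi> > 0"
    using assms by (auto intro!: cos_gt_zero sin_gt_zero)
  ultimately show "\<bar>Re (of_real (\<sigma> * \<bar>t\<bar>) * cis (- sgn t * \<phi>))\<bar> * sin \<omega>
      < \<bar>Im (of_real (\<sigma> * \<bar>t\<bar>) * cis (- sgn t * \<phi>))\<bar> * cos \<omega>"
    using \<sigma> t by (auto simp: sgn_if abs_mult mult.assoc)
qed

lemma omega_calc_commutes: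
  fixes T :: "('v::banach, 'n::{finite,linorder}) operator"
  assumes \<omega>: "0 < \<omega>" "\<omega> < pi / 2" and T: "T \<in> closed_ops" "bisectorial \<omega> T"
    and \<theta>: "\<theta> < pi / 2" and f: "f \<in> intrinsic (double_sector \<theta>)"
    and \<phi>: "\<phi> \<in> {\<omega><..<\<theta>}" and J: "J \<in> imag_units" and B: "op_commutes B T"
  shows "B o\<^sub>L omega_calc \<phi> J T f = omega_calc \<phi> J T f o\<^sub>L B"
proof -
  define L where "L X = (B o\<^sub>L X) - (X o\<^sub>L B)" for X
  have L: "bounded_linear L"
    unfolding L_def
    by (intro bounded_linear_sub bounded_bilinear.bounded_linear_left[OF bounded_bilinear_blinfun_compose]
        bounded_bilinear.bounded_linear_right[OF bounded_bilinear_blinfun_compose])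
  define F where "F \<sigma> t = S_L_resolvent (contour \<phi> J \<sigma> t) T o\<^sub>L
     lmult_op ((vector_derivative (contour \<phi> J \<sigma>) (at t) \<odot>\<^sub>L pv_inverse J)
               \<odot>\<^sub>L f (contour \<phi> J \<sigma> t))" for \<sigma> t
  have LF: "L (F \<sigma> t + F \<sigma> (- t)) = 0" if \<sigma>: "\<sigma> \<in> {1, -1}" and t: "t \<noteq> 0" for \<sigma> t
  proof -
    define w where "w = of_real (\<sigma> * \<bar>t\<bar>) * cis (- sgn t * \<phi>)"
    define d where "d = of_real (\<sigma> * sgn t) * cis (- sgn t * \<phi>)"
    obtain c where c: "f (contour \<phi> J \<sigma> t) = cl_of_complex J c"
      "f (contour \<phi> J \<sigma> (- t)) = cl_of_complex J (cnj c)"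
      by (rule intrinsic_on_contour[OF f _ _ \<sigma> t J, of \<phi>]) (use \<phi> \<omega> in auto)
    define z where "z = d * - \<i> * c"
    have s: "contour \<phi> J \<sigma> t = cl_of_complex J w" "contour \<phi> J \<sigma> (- t) = cl_of_complex J (cnj w)"
      by (simp_all only: w_def contour_minus contour_eq[of \<phi> J \<sigma> t])
    have d: "vector_derivative (contour \<phi> J \<sigma>) (at t) = cl_of_complex J d"
      unfolding d_def by (rule vector_derivative_contour[OF t])
    have d': "vector_derivative (contour \<phi> J \<sigma>) (at (- t)) = cl_of_complex J (- cnj d)"
      using t by (simp add: d_def vector_derivative_contour sgn_minus cis_cnj)
    have Ft: "F \<sigma> t = S_L_resolvent (cl_of_complex J w) T o\<^sub>L lmult_op (cl_of_complex J z)"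
      unfolding F_def d pv_inverse_imag_unit[OF J] c cl_of_complex_mult_cl[OF J]
      unfolding s z_def ..
    have Fmt: "F \<sigma> (- t) = S_L_resolvent (cl_of_complex J (cnj w)) T o\<^sub>L lmult_op (cl_of_complex J (cnj z))"
      unfolding F_def d' pv_inverse_imag_unit[OF J] c cl_of_complex_mult_cl[OF J]
      unfolding s z_def by simp
    have "cl_of_complex J w \<in> S_resolvent_set T"
      using contour_in_S_resolvent_set[OF \<omega> T(2) J _ _ \<sigma> t, of \<phi>] \<phi> \<theta> by (simp add: s)
    then obtain R where R: "is_bounded_inverse (Q_op (cl_of_complex J w) T) R"
      by (auto simp: S_resolvent_set_def)
    have BR: "blinfun_apply B (blinfun_apply R v) = blinfun_apply R (blinfun_apply B v)" for v
      by (rule op_commutes_bounded_inverse[OF R]) (simp add: Q_op_def op_commutes_poly[OF B])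
    have "blinfun_apply (L (F \<sigma> t + F \<sigma> (- t))) v = 0" for v
      unfolding L_def blinfun.diff_left blinfun_apply_blinfun_compose
        Ft Fmt S_L_resolvent_add_cnj[OF T(1) J R]
      by (simp only: blinfun.diff_right blinfun.scaleR_right BR
          op_commutes_T_Q_inverse[OF T(1) R B] diff_self)
    then show ?thesis by (intro blinfun_eqI) simp
  qed
  have "L (integral UNIV (F \<sigma>)) = 0" if "\<sigma> \<in> {1, -1}" for \<sigma>
    by (rule bounded_linear_integral_reflect_zero[OF L, of "F \<sigma>"]) (rule LF[OF that])
  then have "L (omega_calc \<phi> J T f) = 0"
    unfolding omega_calc_def F_def[symmetric]
    by (simp add: linear_simps(5)[OF L] linear_simps(1)[OF L])
  then show ?thesis by (simp add: L_def)
qed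

lemma bnd_calc_commutes:
  fixes T :: "('v::banach, 'n::{finite,linorder}) operator"
  assumes \<omega>: "0 < \<omega>" "\<omega> < pi / 2" and T: "T \<in> closed_ops" "bisectorial \<omega> T"
    and \<theta>: "\<theta> < pi / 2" and g: "g \<in> N_bnd \<theta>"
    and \<phi>: "\<phi> \<in> {\<omega><..<\<theta>}" and J: "J \<in> imag_units" and B: "op_commutes B T"
  shows "B o\<^sub>L bnd_calc \<theta> \<phi> J T g = bnd_calc \<theta> \<phi> J T g o\<^sub>L B"
proof -
  obtain g0 gi gt where sel: "(SOME (g0, gi, gt). bnd_decomposition \<theta> g g0 gi gt) = (g0, gi, gt)"
    by (metis prod_cases3)
  have "\<exists>x. case x of (g0, gi, gt) \<Rightarrow> bnd_decomposition \<theta> g g0 gi gt"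
    using g by (auto simp: N_bnd_def)
  from someI_ex[OF this] have "gt \<in> intrinsic (double_sector \<theta>)"
    unfolding sel by (simp add: bnd_decomposition_def N0_def)
  then have om: "B o\<^sub>L omega_calc \<phi> J T gt = omega_calc \<phi> J T gt o\<^sub>L B"
    by (rule omega_calc_commutes[OF \<omega> T \<theta> _ \<phi> J B])
  have J': "J \<in> S_resolvent_set T"
    by (rule imag_unit_in_S_resolvent_set[OF \<omega> T(2) J])
  have Q: "Q_op J T = op_poly [:1, 0, 1:] T"
    using J by (simp add: Q_op_def imag_units_def)
  have R: "B o\<^sub>L bounded_inverse (op_poly [:1, 0, 1:] T) = bounded_inverse (op_poly [:1, 0, 1:] T) o\<^sub>L B"
    using is_bounded_inverse_bounded_inverse[OF J'] unfolding Q
    by (intro blinfun_eqI) (simp add: op_commutes_bounded_inverse[OF _ op_commutes_poly[OF B]])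
  have I: "B o\<^sub>L id_blinfun = id_blinfun o\<^sub>L B"
    by (intro blinfun_eqI) simp
  show ?thesis
    unfolding bnd_calc_def sel Let_def prod.case
    by (simp add: bounded_bilinear.add_left[OF bounded_bilinear_blinfun_compose]
      bounded_bilinear.add_right[OF bounded_bilinear_blinfun_compose]
      bounded_bilinear.scaleR_left[OF bounded_bilinear_blinfun_compose]
      bounded_bilinear.scaleR_right[OF bounded_bilinear_blinfun_compose] om R I)
qed

lemma op_commutes_bnd_calc:
  fixes T :: "('v::banach, 'n::{finite,linorder}) operator"
  assumes \<omega>: "0 < \<omega>" "\<omega> < pi / 2" and T: "T \<in> closed_ops" "bisectorial \<omega> T"
    and \<theta>: "\<theta> < pi / 2" and g: "g \<in> N_bnd \<theta>"
    and \<phi>: "\<phi> \<in> {\<omega><..<\<theta>}" and J: "J \<in> imag_units"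
  shows "op_commutes (bnd_calc \<theta> \<phi> J T g) T"
proof -
  have "J \<in> S_resolvent_set T"
    by (rule imag_unit_in_S_resolvent_set[OF \<omega> T(2) J])
  then obtain R where R: "is_bounded_inverse (Q_op J T) R"
    by (auto simp: S_resolvent_set_def)
  define TR where "TR = Blinfun (\<lambda>v. the (T (blinfun_apply R v)))"
  have TR: "blinfun_apply TR v = the (T (blinfun_apply R v))" for v
    unfolding TR_def by (rule blinfun_apply_T_Q_inverse[OF T(1) R])
  have RT: "op_commutes R T"
    by (rule op_commutes_Q_inverse[OF T(1) R])
  have "op_commutes TR T"
    unfolding op_commutes_def TR
  proof (intro allI impI)
    fix v w
    assume vw: "T v = Some w"
    then have "T (blinfun_apply R v) = Some (blinfun_apply R w)"
      using RT by (simp add: op_commutes_def)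
    then show "T (the (T (blinfun_apply R v))) = Some (the (T (blinfun_apply R w)))"
      using Q_inverse_dom[OF T(1) R, of w] by auto
  qed
  note comm = bnd_calc_commutes[OF \<omega> T \<theta> g \<phi> J]
  show ?thesis
  proof (rule op_commutes_of_Q_inverse[OF T(1) R])
    let ?A = "blinfun_apply (bnd_calc \<theta> \<phi> J T g)"
    show "?A (blinfun_apply R v) = blinfun_apply R (?A v)" for v
      using comm[OF RT] by (metis blinfun_apply_blinfun_compose)
    show "?A (the (T (blinfun_apply R v))) = the (T (blinfun_apply R (?A v)))" for v
      using comm[OF \<open>op_commutes TR T\<close>] TR by (metis blinfun_apply_blinfun_compose)
  qed
qed

theorem corollary4p12:
  fixes T :: "('v::banach, 'n::{finite,linorder}) operator"
    and \<omega> \<theta> \<phi> :: real and J :: "'n cliff" and g :: "'n cliff \<Rightarrow> 'n cliff"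
  assumes "0 < \<omega>" and "\<omega> < pi / 2"
    and "T \<in> closed_ops" and "bisectorial \<omega> T"
    and "\<omega> < \<theta>" and "\<theta> < pi / 2"
    and "g \<in> N_bnd \<theta>"
    and "\<phi> \<in> {\<omega><..<\<theta>}" and "J \<in> imag_units"
  shows "(\<forall>B\<in>bounded_ops. op_of B \<circ>\<^sub>m T \<subseteq>\<^sub>m T \<circ>\<^sub>m op_of B \<longrightarrow>
            B o\<^sub>L bnd_calc \<theta> \<phi> J T g = bnd_calc \<theta> \<phi> J T g o\<^sub>L B) \<and>
         (\<forall>p::real poly. p \<noteq> 0 \<longrightarrow>
            op_of (bnd_calc \<theta> \<phi> J T g) \<circ>\<^sub>m op_poly p T
              \<subseteq>\<^sub>m op_poly p T \<circ>\<^sub>m op_of (bnd_calc \<theta> \<phi> J T g)) \<and>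
         (\<forall>f\<in>N_bnd \<theta>. \<forall>\<phi>'\<in>{\<omega><..<\<theta>}. \<forall>J'\<in>imag_units.
            bnd_calc \<theta> \<phi> J T g o\<^sub>L bnd_calc \<theta> \<phi>' J' T f
              = bnd_calc \<theta> \<phi>' J' T f o\<^sub>L bnd_calc \<theta> \<phi> J T g)"
proof (intro conjI ballI allI impI)
  note T = assms(1-4) and \<theta> = assms(6)
  fix B :: "('v, 'n) bop"
  assume "op_of B \<circ>\<^sub>m T \<subseteq>\<^sub>m T \<circ>\<^sub>m op_of B"
  then show "B o\<^sub>L bnd_calc \<theta> \<phi> J T g = bnd_calc \<theta> \<phi> J T g o\<^sub>L B"
    using bnd_calc_commutes[OF T \<theta> assms(7-9)] by (simp add: op_commutes_iff)
next
  fix p :: "real poly"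
  show "op_of (bnd_calc \<theta> \<phi> J T g) \<circ>\<^sub>m op_poly p T
      \<subseteq>\<^sub>m op_poly p T \<circ>\<^sub>m op_of (bnd_calc \<theta> \<phi> J T g)"
    unfolding op_commutes_iff[symmetric]
    by (intro op_commutes_poly op_commutes_bnd_calc[OF assms(1-4,6-9)])
next
  fix f :: "'n cliff \<Rightarrow> 'n cliff" and \<phi>' and J' :: "'n cliff"
  assume "f \<in> N_bnd \<theta>" "\<phi>' \<in> {\<omega><..<\<theta>}" "J' \<in> imag_units"
  then have "op_commutes (bnd_calc \<theta> \<phi>' J' T f) T"
    by (rule op_commutes_bnd_calc[OF assms(1-4,6)])
  then show "bnd_calc \<theta> \<phi> J T g o\<^sub>L bnd_calc \<theta> \<phi>' J' T f
      = bnd_calc \<theta> \<phi>' J' T f o\<^sub>L bnd_calc \<theta> \<phi> J T g"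
    using bnd_calc_commutes[OF assms(1-4,6-9)] by metis
qed

end
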